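(* Let $V$ be a finite-dimensional vector space over the finite field $\mathbb{F}_q$. For all subspaces $S, T \subseteq V$, the function $\mathfrak{N}$ satisfies (i) (log-supermodularity) $\mathfrak{N}(S)\cdot \mathfrak{N}(T) \le \mathfrak{N}(S\cap T)\cdot \mathfrak{N}(S+T)$; (ii) (supermodularity) $\mathfrak{N}(S)+\mathfrak{N}(T) \le \mathfrak{N}(S\cap T)+\mathfrak{N}(S+T)$.
   Context: An atom is a one-dimensional subspace of $V$. For a subspace $S\subseteq V$, a set of atoms $\{A_1,\dots,A_k\}$ is an atomic decomposition of $S$ if $A_1+\cdots+A_k=S$. It is minimal if no proper subset of it is an atomic decomposition of $S$. $\mathfrak{N}(S)$ denotes the number of minimal atomic decompositions of $S$. *)

theory Defs
  imports Complex_Main "HOL-Library.Set_Algebras"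
begin

definition atom :: "('k::field \<Rightarrow> 'v::ab_group_add \<Rightarrow> 'v) \<Rightarrow> 'v set \<Rightarrow> bool" where
  "atom scale A \<longleftrightarrow> module.subspace scale A \<and> vector_space.dim scale A = 1"

text \<open>
  The sum below is the iterated Minkowski sum of the members of \<open>D\<close>
  (theory \<^theory>\<open>HOL-Library.Set_Algebras\<close>). The empty sum is \<open>{0}\<close>, so \<open>D = {}\<close> is an
  atomic decomposition of the zero subspace, which thus has exactly one minimal decomposition.
\<close>
definition atomic_decomposition ::
    "('k::field \<Rightarrow> 'v::ab_group_add \<Rightarrow> 'v) \<Rightarrow> 'v set set \<Rightarrow> 'v set \<Rightarrow> bool" where
  "atomic_decomposition scale D S \<longleftrightarrow> finite D \<and> (\<forall>A\<in>D. atom scale A) \<and> (\<Sum>A\<in>D. A) = S"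

definition minimal_atomic_decomposition ::
    "('k::field \<Rightarrow> 'v::ab_group_add \<Rightarrow> 'v) \<Rightarrow> 'v set set \<Rightarrow> 'v set \<Rightarrow> bool" where
  "minimal_atomic_decomposition scale D S \<longleftrightarrow>
     atomic_decomposition scale D S \<and> (\<forall>D'. D' \<subset> D \<longrightarrow> \<not> atomic_decomposition scale D' S)"

definition num_minimal_decompositions ::
    "('k::field \<Rightarrow> 'v::ab_group_add \<Rightarrow> 'v) \<Rightarrow> 'v set \<Rightarrow> nat" where
  "num_minimal_decompositions scale S = card {D. minimal_atomic_decomposition scale D S}"

end

theory Submission
  imports Defs "HOL-Library.Cardinality" "HOL-Combinatorics.Multiset_Permutations"
begin

text \<open>
  The number of minimal atomic decompositions of a subspace depends only on its dimension, and as
  a function of the dimension it is log-convex and increasing; both inequalities follow from this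
  together with \<open>dim S + dim T = dim (S \<inter> T) + dim (S + T)\<close>.

  In detail, a set of atoms spanning an \<open>n\<close>-dimensional \<open>S\<close> is minimal exactly when it has \<open>n\<close>
  elements (\<open>minimal_atomic_decomposition_iff\<close>), so minimal decompositions are bases up to scaling
  of the basis vectors. Write \<open>[i] = 1 + q + \<dots> + q ^ (i - 1)\<close> for the number of atoms in dimension
  \<open>i\<close>. Choosing the atoms of an ordered decomposition one at a time, the next atom has to avoid the
  \<open>[i]\<close> atoms in the span of the \<open>i\<close> chosen ones, so there are \<open>\<Prod>i<n. [n] - [i]\<close> ordered
  decompositions (\<open>card_frames\<close>). Dividing by the \<open>n!\<close> orderings and using
  \<open>[n] - [i] = q ^ i * [n - i]\<close> gives
  \<open>\<N>(S) = (\<Prod>i<n. q ^ i * [i + 1] / (i + 1))\<close> (\<open>num_minimal_decompositions_eq\<close>).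

  The factors of this product start at \<open>1\<close> and increase with \<open>i\<close>, because the step from \<open>i\<close> to
  \<open>i + 1\<close> multiplies \<open>[i + 1]\<close> by at least \<open>1\<close> and \<open>q ^ i / (i + 1)\<close> by
  \<open>q * (i + 1) / (i + 2) \<ge> 1\<close>. Hence lengthening a product by \<open>dim S - dim (S \<inter> T)\<close> factors
  gains at least as much from \<open>dim T\<close> to \<open>dim (S + T)\<close> than from \<open>dim (S \<inter> T)\<close> to \<open>dim S\<close>, which is
  log-supermodularity (\<open>ratio_mono_imp_mult_le\<close>). Supermodularity then follows from
  \<open>\<N>(S \<inter> T) \<le> \<N>(S), \<N>(T)\<close> by elementary algebra (\<open>mult_le_imp_add_le\<close>).
\<close>

section \<open>Sequences with increasing ratios\<close>

text \<open>
  Log-convexity in the form that fits a modular dimension function: \<open>f (c + i)\<close> and \<open>f (d + i)\<close>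
  arise from \<open>f c\<close> and \<open>f d\<close> by \<open>i\<close> consecutive ratios each, and the ratios starting at \<open>d\<close> are
  the larger ones.
\<close>

lemma ratio_mono_imp_mult_le:
  fixes f r :: "nat \<Rightarrow> real"
  assumes step: "\<And>n. f (Suc n) = f n * r n"
    and nonneg: "\<And>n. 0 \<le> f n" "\<And>n. 0 \<le> r n"
    and "mono r" and "c \<le> d"
  shows "f (c + i) * f d \<le> f c * f (d + i)"
proof -
  have tele: "f (m + i) = f m * (\<Prod>j<i. r (m + j))" for m
    by (induction i) (simp_all add: step mult.assoc)
  have "(\<Prod>j<i. r (c + j)) \<le> (\<Prod>j<i. r (d + j))"
    using nonneg \<open>mono r\<close> \<open>c \<le> d\<close> by (intro prod_mono) (simp add: monoD)
  then have "(f c * f d) * (\<Prod>j<i. r (c + j)) \<le> (f c * f d) * (\<Prod>j<i. r (d + j))"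
    using nonneg by (intro mult_left_mono) simp_all
  then show ?thesis
    by (simp add: tele mult_ac)
qed

text \<open>
  Expanding \<open>(x - z) * (y - z) \<ge> 0\<close> gives \<open>z * (x + y) \<le> x * y + z * z\<close>. For a monotone function
  this turns log-supermodularity into supermodularity.
\<close>

lemma mult_le_imp_add_le:
  fixes x y z w :: real
  assumes "x * y \<le> z * w" and "0 < z" "z \<le> x" "z \<le> y"
  shows "x + y \<le> z + w"
proof -
  have "0 \<le> (x - z) * (y - z)"
    using assms by simp
  then have "z * (x + y) \<le> z * (z + w)"
    using assms(1) by (simp add: algebra_simps)
  then show ?thesis
    using \<open>0 < z\<close> by simp
qed

section \<open>The number of bases up to scaling\<close>

definition q_number :: "nat \<Rightarrow> nat \<Rightarrow> nat" where
  "q_number q n = (\<Sum>i<n. q ^ i)"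

lemma q_number_Suc: "q_number q (Suc n) = 1 + q * q_number q n"
  by (simp add: q_number_def sum.lessThan_Suc_shift sum_distrib_left del: sum.lessThan_Suc)

lemma q_number_mult_pred: "(q - 1) * q_number q n = q ^ n - 1"
proof (cases "q = 0")
  case True
  then show ?thesis by (cases n) simp_all
next
  case False
  then obtain p where q: "q = Suc p" by (cases q) auto
  have "p * q_number q n + 1 = q ^ n"
    by (induction n) (simp_all add: q q_number_def algebra_simps)
  then show ?thesis by (simp add: q)
qed

text \<open>
  Both sides come from \<open>[n] - [i] = q ^ i * [n - i]\<close>: the exponents and the arguments \<open>n - i\<close> are
  distributed differently over the factors. The right-hand side has factors that do not depend on \<open>n\<close>,
  so passing from \<open>n\<close> to \<open>n + 1\<close> is multiplication by a single term.
\<close>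

lemma prod_q_number_diff:
  "(\<Prod>i<n. q_number q n - q_number q i) = (\<Prod>i<n. q ^ i * q_number q (Suc i))"
proof (induction n)
  case (Suc n)
  have "(\<Prod>i<Suc n. q_number q (Suc n) - q_number q i)
      = q_number q (Suc n) * (\<Prod>i<n. q * (q_number q n - q_number q i))"
    by (simp add: prod.lessThan_Suc_shift q_number_Suc diff_mult_distrib2 del: prod.lessThan_Suc)
      (simp add: q_number_def)
  also have "\<dots> = q_number q (Suc n) * q ^ n * (\<Prod>i<n. q ^ i * q_number q (Suc i))"
    by (simp add: prod.distrib[of "\<lambda>_. q"] Suc)
  finally show ?case by simp
qed simp

text \<open>
  The factor by which the number of unordered bases up to scaling grows from dimension \<open>n\<close> to
  dimension \<open>n + 1\<close> over a field with \<open>q\<close> elements.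
\<close>

definition atom_basis_ratio :: "nat \<Rightarrow> nat \<Rightarrow> real" where
  "atom_basis_ratio q n = real (q ^ n * q_number q (Suc n)) / real (Suc n)"

definition atom_basis_count :: "nat \<Rightarrow> nat \<Rightarrow> real" where
  "atom_basis_count q n = (\<Prod>i<n. atom_basis_ratio q i)"

lemma atom_basis_count_Suc: "atom_basis_count q (Suc n) = atom_basis_count q n * atom_basis_ratio q n"
  by (simp add: atom_basis_count_def)

lemma atom_basis_count_mult_fact:
  "atom_basis_count q n * fact n = real (\<Prod>i<n. q_number q n - q_number q i)"
  unfolding prod_q_number_diff
  by (induction n) (simp_all add: atom_basis_count_def atom_basis_ratio_def field_simps)

text \<open>
  This is where \<open>q \<ge> 2\<close> enters: the growth \<open>(n + 2) / (n + 1) \<le> 2\<close> of the denominator is absorbed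
  by one factor \<open>q\<close>.
\<close>

lemma mono_atom_basis_ratio:
  assumes "2 \<le> q"
  shows "mono (atom_basis_ratio q)"
proof (rule incseq_SucI)
  fix n
  have "Suc (Suc n) \<le> 2 * Suc n" by simp
  also have "\<dots> \<le> q * Suc n" using assms by (rule mult_right_mono) simp
  finally have "real (Suc (Suc n)) \<le> real (q * Suc n)" by (rule of_nat_mono)
  moreover have "real (q_number q (Suc n)) \<le> real (q_number q (Suc (Suc n)))"
    by (simp add: q_number_def)
  ultimately have "real (q_number q (Suc n)) * real (Suc (Suc n))
      \<le> real (q_number q (Suc (Suc n))) * real (q * Suc n)"
    by (intro mult_mono) simp_all
  then have "real (q ^ n) * (real (q_number q (Suc n)) * real (Suc (Suc n)))
      \<le> real (q ^ n) * (real (q_number q (Suc (Suc n))) * real (q * Suc n))"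
    by (intro mult_left_mono) simp_all
  then show "atom_basis_ratio q n \<le> atom_basis_ratio q (Suc n)"
    unfolding atom_basis_ratio_def
    by (simp add: field_simps)
qed

lemma atom_basis_ratio_ge_1:
  assumes "2 \<le> q"
  shows "1 \<le> atom_basis_ratio q n"
proof -
  have "atom_basis_ratio q 0 = 1" by (simp add: atom_basis_ratio_def q_number_def)
  then show ?thesis using monoD[OF mono_atom_basis_ratio[OF assms], of 0 n] by simp
qed

lemma atom_basis_count_pos:
  assumes "2 \<le> q"
  shows "0 < atom_basis_count q n"
  using atom_basis_ratio_ge_1[OF assms] unfolding atom_basis_count_def
  by (intro prod_pos) (simp add: less_le_trans[OF zero_less_one])

lemma mono_atom_basis_count:
  assumes "2 \<le> q"
  shows "mono (atom_basis_count q)"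
  using atom_basis_ratio_ge_1[OF assms] atom_basis_count_pos[OF assms]
  by (intro incseq_SucI) (simp add: atom_basis_count_Suc less_imp_le)

section \<open>Counting atoms\<close>

locale finite_vector_space = finite_dimensional_vector_space scale Basis
  for scale :: "'k::{field,finite} \<Rightarrow> 'v::ab_group_add \<Rightarrow> 'v" (infixr \<open>*s\<close> 75)
    and Basis :: "'v set"
begin

lemma q_ge_2: "2 \<le> CARD('k)"
proof -
  have "card {0, 1 :: 'k} \<le> CARD('k)" by (rule card_mono) simp_all
  then show ?thesis by simp
qed

text \<open>
  Over a finite field, adjoining a vector \<open>b\<close> outside the span of \<open>B\<close> multiplies the span by \<open>q\<close>,
  since \<open>k *s b + x\<close> with \<open>x\<close> in the span of \<open>B\<close> determines \<open>k\<close> and \<open>x\<close>.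
\<close>

lemma card_span_independent:
  assumes "finite B" "independent B"
  shows "finite (span B) \<and> card (span B) = CARD('k) ^ card B"
  using assms
proof (induction B)
  case (insert b B)
  have indep: "independent B" and b: "b \<notin> span B"
    using insert.prems insert.hyps by (simp_all add: independent_insert)
  have inj: "inj_on (\<lambda>(k, x). k *s b + x) (UNIV \<times> span B)"
  proof (rule inj_onI, clarify)
    fix k l x y
    assume xy: "x \<in> span B" "y \<in> span B" and eq: "k *s b + x = l *s b + y"
    then have "(k - l) *s b = y - x" by (simp add: algebra_simps)
    then have mem: "(k - l) *s b \<in> span B" using xy by (simp add: span_diff)
    have "k = l"
    proof (rule ccontr)
      assume "k \<noteq> l"
      then have "b = inverse (k - l) *s ((k - l) *s b)" by simp
      also have "\<dots> \<in> span B" using mem by (rule span_scale)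
      finally show False using b by simp
    qed
    then show "k = l \<and> x = y" using eq by simp
  qed
  have "span (insert b B) = (\<lambda>(k, x). k *s b + x) ` (UNIV \<times> span B)"
  proof (intro set_eqI iffI)
    fix v assume "v \<in> span (insert b B)"
    then obtain k where "v - k *s b \<in> span B" unfolding span_insert by blast
    then have "(k, v - k *s b) \<in> UNIV \<times> span B" by simp
    then show "v \<in> (\<lambda>(k, x). k *s b + x) ` (UNIV \<times> span B)"
      by (rule rev_image_eqI) simp
  next
    fix v assume "v \<in> (\<lambda>(k, x). k *s b + x) ` (UNIV \<times> span B)"
    then obtain k x where "v = k *s b + x" "x \<in> span B" by auto
    then have "v - k *s b \<in> span B" by simp
    then show "v \<in> span (insert b B)" unfolding span_insert by blast
  qed
  then show ?case
    using insert.IH[OF indep] insert.hyps card_image[OF inj]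
    by (simp add: card_cartesian_product)
qed simp

lemma card_subspace:
  assumes "subspace S"
  shows "finite S \<and> card S = CARD('k) ^ dim S"
  using basis_subspace_exists[OF assms] card_span_independent by metis

abbreviation atoms :: "'v set \<Rightarrow> 'v set set" where
  "atoms S \<equiv> {A. atom scale A \<and> A \<subseteq> S}"

lemma atom_span_singleton: "v \<noteq> 0 \<Longrightarrow> atom scale (span {v})"
  by (simp add: atom_def)

lemma atom_eq_span:
  assumes "atom scale A" "v \<in> A" "v \<noteq> 0"
  shows "A = span {v}"
  using assms subspace_dim_equal[of "span {v}" A]
  by (simp add: atom_def span_minimal)

lemma atomE:
  assumes "atom scale A"
  obtains v where "v \<noteq> 0" "A = span {v}"
proof -
  have "\<not> A \<subseteq> {0}"
    using assms dim_eq_0[of A] by (simp add: atom_def del: dim_eq_0)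
  then show thesis using atom_eq_span[OF assms] that by blast
qed

lemma finite_atoms: "finite (atoms S)"
proof -
  have "finite (UNIV :: 'v set)" using card_subspace[OF subspace_UNIV] by simp
  then have "finite (UNIV :: 'v set set)" by (simp add: Finite_Set.finite_set)
  then show ?thesis by (rule rev_finite_subset) simp
qed

text \<open>
  The nonzero vectors of \<open>S\<close> are partitioned by the atoms in \<open>S\<close>, each of which contains \<open>q - 1\<close> of them.
\<close>

lemma card_atoms:
  assumes "subspace S"
  shows "card (atoms S) = q_number CARD('k) (dim S)"
proof -
  have S: "finite S" "card S = CARD('k) ^ dim S" using card_subspace[OF assms] by simp_all
  have part: "(\<Union>A\<in>atoms S. A - {0}) = S - {0}"
  proof (intro subset_antisym subsetI)
    fix v assume "v \<in> S - {0}"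
    then have "span {v} \<in> atoms S" "v \<in> span {v} - {0}"
      using assms by (simp_all add: atom_span_singleton span_minimal span_base)
    then show "v \<in> (\<Union>A\<in>atoms S. A - {0})" by blast
  qed auto
  have card_A: "card (A - {0}) = CARD('k) - 1" if "A \<in> atoms S" for A
    using that card_subspace[of A] by (simp add: atom_def subspace_0)
  have "card (S - {0}) = (\<Sum>A\<in>atoms S. card (A - {0}))"
    unfolding part[symmetric]
  proof (rule card_UN_disjoint[OF finite_atoms])
    show "\<forall>A\<in>atoms S. finite (A - {0})" using S by (auto intro: finite_subset)
    show "\<forall>A\<in>atoms S. \<forall>B\<in>atoms S. A \<noteq> B \<longrightarrow> (A - {0}) \<inter> (B - {0}) = {}"
      using atom_eq_span by blast
  qed
  also have "\<dots> = (CARD('k) - 1) * card (atoms S)" using card_A by simp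
  finally have "(CARD('k) - 1) * card (atoms S) = CARD('k) ^ dim S - 1"
    using S assms by (simp add: subspace_0)
  also have "\<dots> = (CARD('k) - 1) * q_number CARD('k) (dim S)" by (rule q_number_mult_pred[symmetric])
  finally show ?thesis using q_ge_2 by simp
qed

section \<open>Minimal decompositions and frames\<close>

lemma sum_subspaces_eq_span:
  assumes "finite D" "\<forall>A\<in>D. subspace A"
  shows "(\<Sum>A\<in>D. A) = span (\<Union>D)"
  using assms
proof (induction D)
  case (insert A D)
  then have span_A: "span A = A" by simp
  have "span (\<Union>(insert A D)) = A + span (\<Union>D)"
    by (auto simp: span_Un span_A set_plus_def)
  then show ?case
    using insert by simp
qed (simp add: set_zero)

lemma atomic_decomposition_iff:
  "atomic_decomposition scale D S \<longleftrightarrow> finite D \<and> (\<forall>A\<in>D. atom scale A) \<and> span (\<Union>D) = S"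
  using sum_subspaces_eq_span[of D] unfolding atomic_decomposition_def atom_def by auto

lemma dim_Un_atom:
  assumes "atom scale A"
  shows "dim (A \<union> X) = (if A \<subseteq> span X then dim X else Suc (dim X))"
proof -
  obtain v where v: "A = span {v}" using atomE[OF assms] by blast
  have "span (A \<union> X) = span (insert v X)"
    unfolding span_Un v insert_is_Un[of v X] span_span ..
  then have "dim (A \<union> X) = dim (insert v X)" by (rule span_eq_dim)
  moreover have "A \<subseteq> span X \<longleftrightarrow> v \<in> span X"
    unfolding v by (auto intro: span_base subsetD[OF span_minimal])
  ultimately show ?thesis by (simp add: dim_insert)
qed

lemma dim_Union_atoms_le:
  assumes "finite D" "\<forall>A\<in>D. atom scale A"
  shows "dim (\<Union>D) \<le> card D"
  using assms by (induction D) (auto simp: dim_Un_atom)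

text \<open>
  The atoms are added one at a time, and those that already lie in the span of the earlier ones are dropped.
\<close>

lemma ex_subset_atoms_basis:
  assumes "finite D" "\<forall>A\<in>D. atom scale A"
  shows "\<exists>D'\<subseteq>D. card D' = dim (\<Union>D) \<and> span (\<Union>D') = span (\<Union>D)"
  using assms
proof (induction D)
  case (insert A D)
  then obtain D' where D': "D' \<subseteq> D" "card D' = dim (\<Union>D)" "span (\<Union>D') = span (\<Union>D)"
    by auto
  have span_eq: "span (A \<union> \<Union>D') = span (A \<union> \<Union>D)"
    using D'(3) by (simp add: span_Un)
  show ?case
  proof (cases "A \<subseteq> span (\<Union>D)")
    case True
    then have "span (\<Union>D) = span (\<Union>(insert A D))"
      by (intro subset_antisym span_mono span_minimal) (auto intro: span_base)
    then show ?thesis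
      using True D' insert.prems by (intro exI[of _ D']) (auto simp: dim_Un_atom)
  next
    case False
    then show ?thesis
      using D' insert span_eq finite_subset[OF D'(1)]
      by (intro exI[of _ "insert A D'"]) (auto simp: dim_Un_atom card_insert_if)
  qed
qed auto

text \<open>
  A minimal decomposition coincides with the \<open>dim S\<close> atoms that can be selected from it;
  conversely fewer than \<open>dim S\<close> atoms cannot span \<open>S\<close>.
\<close>

lemma minimal_atomic_decomposition_iff:
  "minimal_atomic_decomposition scale D S \<longleftrightarrow> atomic_decomposition scale D S \<and> card D = dim S"
proof (cases "atomic_decomposition scale D S")
  case True
  then have fin: "finite D" and at: "\<forall>A\<in>D. atom scale A" and sp: "span (\<Union>D) = S"
    by (simp_all add: atomic_decomposition_iff)
  have dimS: "dim (\<Union>D) = dim S" using sp by (metis dim_span)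
  show ?thesis
  proof
    assume min: "minimal_atomic_decomposition scale D S"
    obtain D' where D': "D' \<subseteq> D" "card D' = dim S" "span (\<Union>D') = S"
      using ex_subset_atoms_basis[OF fin at] sp dimS by auto
    have "atomic_decomposition scale D' S"
      using D' fin at finite_subset by (auto simp: atomic_decomposition_iff)
    then have "D' = D" using min D'(1) unfolding minimal_atomic_decomposition_def by blast
    then show "atomic_decomposition scale D S \<and> card D = dim S" using True D' by simp
  next
    assume card: "atomic_decomposition scale D S \<and> card D = dim S"
    have "\<not> atomic_decomposition scale D' S" if "D' \<subset> D" for D'
    proof
      assume "atomic_decomposition scale D' S"
      then have "dim S \<le> card D'"
        using dim_Union_atoms_le[of D'] by (metis atomic_decomposition_iff dim_span)
      then show False using psubset_card_mono[OF fin that] card by simp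
    qed
    then show "minimal_atomic_decomposition scale D S"
      using True by (simp add: minimal_atomic_decomposition_def)
  qed
qed (simp add: minimal_atomic_decomposition_def)

text \<open>
  Independence of a list of atoms is expressed by the dimension of its span being its length; this
  also forces the entries to be distinct.
\<close>

definition frames :: "'v set \<Rightarrow> nat \<Rightarrow> 'v set list set" where
  "frames S k = {xs. length xs = k \<and> set xs \<subseteq> atoms S \<and> dim (\<Union>(set xs)) = k}"

lemma frames_Suc:
  "frames S (Suc k)
    = (\<lambda>(xs, A). A # xs) ` (SIGMA xs:frames S k. atoms S - atoms (span (\<Union>(set xs))))"
proof (intro set_eqI iffI)
  fix ys assume "ys \<in> frames S (Suc k)"
  then obtain A xs where ys: "ys = A # xs" and len: "length xs = k" and A: "A \<in> atoms S"
    and xs: "set xs \<subseteq> atoms S" and dim: "dim (A \<union> \<Union>(set xs)) = Suc k"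
    by (cases ys) (auto simp: frames_def)
  have "dim (\<Union>(set xs)) \<le> card (set xs)"
    using xs by (intro dim_Union_atoms_le) auto
  also have "\<dots> \<le> k" using len card_length by blast
  finally have "\<not> A \<subseteq> span (\<Union>(set xs)) \<and> dim (\<Union>(set xs)) = k"
    using dim A by (auto simp: dim_Un_atom split: if_splits)
  then show "ys \<in> (\<lambda>(xs, A). A # xs) `
      (SIGMA xs:frames S k. atoms S - atoms (span (\<Union>(set xs))))"
    using ys len A xs by (auto simp: frames_def image_iff)
next
  fix ys assume "ys \<in> (\<lambda>(xs, A). A # xs) `
      (SIGMA xs:frames S k. atoms S - atoms (span (\<Union>(set xs))))"
  then obtain xs A where "ys = A # xs" "xs \<in> frames S k" "A \<in> atoms S"
    "\<not> A \<subseteq> span (\<Union>(set xs))"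
    by auto
  then show "ys \<in> frames S (Suc k)"
    by (simp add: frames_def dim_Un_atom)
qed

text \<open>
  The number of ways to extend an independent list of length \<open>k\<close> depends only on \<open>k\<close>, because its
  span is always a \<open>k\<close>-dimensional subspace of \<open>S\<close>, all of whose atoms are excluded.
\<close>

lemma card_frames:
  assumes "subspace S"
  shows "finite (frames S k) \<and> card (frames S k) = (\<Prod>i<k. q_number CARD('k) (dim S) - q_number CARD('k) i)"
proof (induction k)
  case 0
  have "frames S 0 = {[]}" by (auto simp: frames_def)
  then show ?case by simp
next
  case (Suc k)
  have new: "card (atoms S - atoms (span (\<Union>(set xs)))) = q_number CARD('k) (dim S) - q_number CARD('k) k"
    if "xs \<in> frames S k" for xs
  proof -
    have "span (\<Union>(set xs)) \<subseteq> S"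
      using that assms by (intro span_minimal) (auto simp: frames_def)
    then have "atoms (span (\<Union>(set xs))) \<subseteq> atoms S" by auto
    then show ?thesis
      using that assms by (simp add: card_Diff_subset finite_atoms card_atoms frames_def)
  qed
  have "inj_on (\<lambda>(xs, A). A # xs) X" for X :: "('v set list \<times> 'v set) set"
    by (auto simp: inj_on_def)
  then show ?case
    using Suc new by (simp add: frames_Suc card_image finite_atoms)
qed

lemma frames_eq_orderings:
  assumes "subspace S"
  shows "frames S (dim S)
    = (\<Union>D\<in>{D. minimal_atomic_decomposition scale D S}. permutations_of_set D)"
proof (intro set_eqI iffI)
  fix xs assume "xs \<in> frames S (dim S)"
  then have len: "length xs = dim S" and at: "set xs \<subseteq> atoms S"
    and dim: "dim (\<Union>(set xs)) = dim S"
    by (auto simp: frames_def)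
  have "dim S \<le> card (set xs)"
    using dim at dim_Union_atoms_le[of "set xs"] by auto
  then have card: "card (set xs) = dim S" using len card_length[of xs] by simp
  then have "distinct xs" using len by (simp add: card_distinct)
  moreover have "span (\<Union>(set xs)) = S"
    using at assms dim by (intro subspace_dim_equal span_minimal) auto
  ultimately show
    "xs \<in> (\<Union>D\<in>{D. minimal_atomic_decomposition scale D S}. permutations_of_set D)"
    using card at
    by (auto simp: minimal_atomic_decomposition_iff atomic_decomposition_iff
        intro!: permutations_of_setI)
next
  fix xs assume
    "xs \<in> (\<Union>D\<in>{D. minimal_atomic_decomposition scale D S}. permutations_of_set D)"
  then have "distinct xs" and card: "card (set xs) = dim S"
    and at: "\<forall>A\<in>set xs. atom scale A" and sp: "span (\<Union>(set xs)) = S"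
    by (auto simp: minimal_atomic_decomposition_iff atomic_decomposition_iff
        dest: permutations_of_setD)
  then have "length xs = dim S" by (simp add: distinct_card)
  moreover have "dim (\<Union>(set xs)) = dim S" using sp by (metis dim_span)
  moreover have "A \<subseteq> S" if "A \<in> set xs" for A
    using that sp span_superset[of "\<Union>(set xs)"] by auto
  ultimately show "xs \<in> frames S (dim S)" using at by (auto simp: frames_def)
qed

lemma num_minimal_decompositions_eq:
  assumes "subspace S"
  shows "real (num_minimal_decompositions scale S) = atom_basis_count CARD('k) (dim S)"
proof -
  let ?M = "{D. minimal_atomic_decomposition scale D S}"
  have M: "finite D \<and> card D = dim S" if "D \<in> ?M" for D
    using that by (simp add: minimal_atomic_decomposition_iff atomic_decomposition_iff)
  have "?M \<subseteq> Pow (atoms UNIV)"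
    by (auto simp: minimal_atomic_decomposition_iff atomic_decomposition_iff)
  then have finM: "finite ?M" using finite_atoms finite_subset by blast
  have "card (frames S (dim S)) = (\<Sum>D\<in>?M. card (permutations_of_set D))"
    unfolding frames_eq_orderings[OF assms]
    using finM by (intro card_UN_disjoint) (auto dest: permutations_of_setD)
  also have "\<dots> = num_minimal_decompositions scale S * fact (dim S)"
    using M by (simp add: num_minimal_decompositions_def)
  finally have "real (num_minimal_decompositions scale S) * fact (dim S)
      = real (\<Prod>i<dim S. q_number CARD('k) (dim S) - q_number CARD('k) i)"
    using card_frames[OF assms] by (metis of_nat_fact of_nat_mult)
  also have "\<dots> = atom_basis_count CARD('k) (dim S) * fact (dim S)"
    by (rule atom_basis_count_mult_fact[symmetric])
  finally show ?thesis by simp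
qed

end

section \<open>Supermodularity\<close>

theorem theorem2:
  fixes scale :: "'k::{field,finite} \<Rightarrow> 'v::ab_group_add \<Rightarrow> 'v"
    and Basis S T :: "'v set"
  assumes "finite_dimensional_vector_space scale Basis"
    and "module.subspace scale S"
    and "module.subspace scale T"
  shows "num_minimal_decompositions scale S * num_minimal_decompositions scale T
      \<le> num_minimal_decompositions scale (S \<inter> T) * num_minimal_decompositions scale (S + T)
    \<and> num_minimal_decompositions scale S + num_minimal_decompositions scale T
      \<le> num_minimal_decompositions scale (S \<inter> T) + num_minimal_decompositions scale (S + T)"
proof -
  interpret finite_vector_space scale Basis
    using assms(1) by (simp add: finite_vector_space_def)
  let ?N = "num_minimal_decompositions scale"
  let ?f = "atom_basis_count CARD('k)"
  have S: "subspace S" and T: "subspace T" using assms by simp_all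
  have plus: "S + T = {x + y |x y. x \<in> S \<and> y \<in> T}" by (auto simp: set_plus_def)
  have sub: "subspace (S \<inter> T)" "subspace (S + T)"
    using S T by (simp_all add: subspace_inter plus subspace_sums)
  have dims: "dim (S + T) + dim (S \<inter> T) = dim S + dim T"
    unfolding plus by (rule dim_sums_Int[OF S T])
  have le: "dim (S \<inter> T) \<le> dim S" "dim (S \<inter> T) \<le> dim T"
    by (simp_all add: dim_subset)
  let ?i = "dim S - dim (S \<inter> T)"
  have mult: "?f (dim S) * ?f (dim T) \<le> ?f (dim (S \<inter> T)) * ?f (dim (S + T))"
  proof -
    have "?f (dim (S \<inter> T) + ?i) * ?f (dim T) \<le> ?f (dim (S \<inter> T)) * ?f (dim T + ?i)"
    proof (rule ratio_mono_imp_mult_le[where r = "atom_basis_ratio CARD('k)"])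
      show "0 \<le> ?f n" for n using atom_basis_count_pos[OF q_ge_2] less_imp_le by blast
      show "0 \<le> atom_basis_ratio CARD('k) n" for n
        using atom_basis_ratio_ge_1[OF q_ge_2, of n] by simp
    qed (simp_all add: atom_basis_count_Suc mono_atom_basis_ratio[OF q_ge_2] le)
    moreover have "dim T + ?i = dim (S + T)" "dim (S \<inter> T) + ?i = dim S" using dims le by simp_all
    ultimately show ?thesis by simp
  qed
  have "?f (dim S) + ?f (dim T) \<le> ?f (dim (S \<inter> T)) + ?f (dim (S + T))"
    using mult atom_basis_count_pos[OF q_ge_2] le[THEN monoD[OF mono_atom_basis_count[OF q_ge_2]]]
    by (rule mult_le_imp_add_le)
  with mult have "real (?N S * ?N T) \<le> real (?N (S \<inter> T) * ?N (S + T))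
      \<and> real (?N S + ?N T) \<le> real (?N (S \<inter> T) + ?N (S + T))"
    by (simp add: num_minimal_decompositions_eq S T sub)
  then show ?thesis by (simp only: of_nat_le_iff)
qed

end
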